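(* Let the bicomplex function $\psi(p)=(\phi_1(a,b),\phi_2(a,b))$, $p=(a,b)$, be holomorphic in a domain $G\subseteq\mathrm{B}$. Then $$\int_\Gamma\psi(p)\odot dp=0$$ for any closed curve $\Gamma$ that is the boundary of an orientable surface $S(\Gamma)$ in $G$.
   Context: $\mathrm{B}=\mathbb{C}^2$ is the space of bicomplex numbers $p=(a,b)$, $a,b\in\mathbb{C}$, with componentwise addition and the commutative multiplication $(a,b)\odot(c,d)=(ac-bd,\ bc+ad)$. The norm is $\|(a,b)\|=\sqrt{|a|^2+|b|^2}$. A bicomplex number $(a,b)$ is singular if $a^2+b^2=0$, and nonsingular otherwise; a nonsingular $(a,b)$ has the inverse $\left(\frac{a}{a^2+b^2},\frac{-b}{a^2+b^2}\right)$, and $r/q=r\odot q^{-1}$ for nonsingular $q$. A domain is a connected open set. A bicomplex function $\psi$ is holomorphic in $G$ if at every $p\in G$ the derivative $$\psi'(p)=\lim_{\Delta p\to 0,\ \Delta p\ \text{nonsingular}}\frac{\psi(p+\Delta p)-\psi(p)}{\Delta p}$$ exists (the limit being taken over nonsingular $\Delta p$ only). A curve $\Gamma$ in $\mathrm{B}$ is a piecewise continuously differentiable path $p(t)=(a(t),b(t))$, $r\le t\le s$, and the line integral is $\int_\Gamma\psi(p)\odot dp=\int_r^s\psi(p(t))\odot p'(t)\,dt$. Surfaces are two-dimensional compact piecewise smooth surfaces in $\mathbb{R}^4=\mathbb{C}^2$; $S(\Gamma)$ is oriented, with boundary $\Gamma$, as in Stokes' theorem. *)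

theory Defs
  imports "HOL-Analysis.Analysis"
begin

text \<open>The library norm and topology on the product \<open>complex \<times> complex\<close> are the Euclidean ones,
  i.e. \<open>norm (a, b) = sqrt ((cmod a)\<^sup>2 + (cmod b)\<^sup>2)\<close>.\<close>

type_synonym bicomplex = "complex \<times> complex"

definition bc_mult :: "bicomplex \<Rightarrow> bicomplex \<Rightarrow> bicomplex"  (infixl "\<odot>" 70)
  where "p \<odot> q = (fst p * fst q - snd p * snd q, snd p * fst q + fst p * snd q)"

definition bc_singular :: "bicomplex \<Rightarrow> bool"
  where "bc_singular p \<longleftrightarrow> (fst p)\<^sup>2 + (snd p)\<^sup>2 = 0"

definition bc_inverse :: "bicomplex \<Rightarrow> bicomplex"
  where "bc_inverse p =
    (fst p / ((fst p)\<^sup>2 + (snd p)\<^sup>2), - snd p / ((fst p)\<^sup>2 + (snd p)\<^sup>2))"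

definition bc_divide :: "bicomplex \<Rightarrow> bicomplex \<Rightarrow> bicomplex"
  where "bc_divide p q = p \<odot> bc_inverse q"

definition has_bc_derivative :: "(bicomplex \<Rightarrow> bicomplex) \<Rightarrow> bicomplex \<Rightarrow> bicomplex \<Rightarrow> bool"
  where "has_bc_derivative \<psi> d p \<longleftrightarrow>
    ((\<lambda>h. bc_divide (\<psi> (p + h) - \<psi> p) h) \<longlongrightarrow> d) (at 0 within {h. \<not> bc_singular h})"

definition bc_holomorphic_on :: "(bicomplex \<Rightarrow> bicomplex) \<Rightarrow> bicomplex set \<Rightarrow> bool"
  where "bc_holomorphic_on \<psi> G \<longleftrightarrow> (\<forall>p\<in>G. \<exists>d. has_bc_derivative \<psi> d p)"

definition bc_curve :: "(real \<Rightarrow> bicomplex) \<Rightarrow> real \<Rightarrow> real \<Rightarrow> bool"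
  where "bc_curve \<gamma> r s \<longleftrightarrow> r \<le> s \<and> \<gamma> piecewise_C1_differentiable_on {r..s}"

text \<open>As for \<open>has_contour_integral\<close>, the relation asserts existence of the integral as well as its
  value. The finitely many parameters at which \<open>\<gamma>\<close> is not differentiable do not matter.\<close>

definition has_bc_line_integral ::
    "(bicomplex \<Rightarrow> bicomplex) \<Rightarrow> bicomplex \<Rightarrow> (real \<Rightarrow> bicomplex) \<Rightarrow> real \<Rightarrow> real \<Rightarrow> bool"
  where "has_bc_line_integral \<psi> I \<gamma> r s \<longleftrightarrow>
    ((\<lambda>t. \<psi> (\<gamma> t) \<odot> vector_derivative \<gamma> (at t within {r..s})) has_integral I) {r..s}"

text \<open>A compact oriented piecewise smooth surface is rendered as a compact topological surface
  (with boundary) in \<open>complex \<times> complex\<close>, cut into finitely many smooth curved triangles which are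
  coherently oriented. The triangles are parametrized over \<open>std_triangle\<close>, whose corners
  \<open>tri_vertex 0\<close>, \<open>tri_vertex 1\<close>, \<open>tri_vertex 2\<close> are in counterclockwise order.\<close>

definition tri_vertex :: "nat \<Rightarrow> real \<times> real"
  where "tri_vertex k = (if k = 0 then (0, 0) else if k = 1 then (1, 0) else (0, 1))"

definition std_triangle :: "(real \<times> real) set"
  where "std_triangle = convex hull {tri_vertex 0, tri_vertex 1, tri_vertex 2}"

text \<open>An injective map, \<open>C\<^sup>1\<close> up to the boundary and regular in the interior. Regularity is not
  required on the boundary, so that cone points and cusps are possible.\<close>

definition smooth_triangle :: "(real \<times> real \<Rightarrow> bicomplex) \<Rightarrow> bool"
  where "smooth_triangle \<sigma> \<longleftrightarrow>
    inj_on \<sigma> std_triangle \<and>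
    (\<exists>D :: real \<times> real \<Rightarrow> (real \<times> real) \<Rightarrow>\<^sub>L bicomplex.
       continuous_on std_triangle D \<and>
       (\<forall>x\<in>std_triangle. (\<sigma> has_derivative blinfun_apply (D x)) (at x within std_triangle)) \<and>
       (\<forall>x\<in>interior std_triangle. inj (blinfun_apply (D x))))"

text \<open>The sides of a curved triangle, traversed counterclockwise, i.e. with the boundary orientation
  of Stokes' theorem.\<close>

definition tri_edge :: "(real \<times> real \<Rightarrow> bicomplex) \<Rightarrow> nat \<Rightarrow> real \<Rightarrow> bicomplex"
  where "tri_edge \<sigma> k = \<sigma> \<circ> linepath (tri_vertex k) (tri_vertex ((k + 1) mod 3))"

text \<open>Since all edges are arcs, two edges with the same image run in opposite directions iff their
  endpoints are interchanged. The last condition below also implies that at most two triangles meet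
  along an edge.\<close>

definition oriented_triangulation ::
    "(real \<times> real \<Rightarrow> bicomplex) set \<Rightarrow> bicomplex set \<Rightarrow> bool"
  where "oriented_triangulation P S \<longleftrightarrow>
    finite P \<and>
    (\<forall>\<sigma>\<in>P. smooth_triangle \<sigma>) \<and>
    S = (\<Union>\<sigma>\<in>P. \<sigma> ` std_triangle) \<and>
    (\<forall>\<sigma>\<in>P. \<forall>\<tau>\<in>P. \<sigma> \<noteq> \<tau> \<longrightarrow>
       \<sigma> ` std_triangle \<inter> \<tau> ` std_triangle = {} \<or>
       (\<exists>k<3. \<exists>l<3. \<sigma> (tri_vertex k) = \<tau> (tri_vertex l) \<and>
          \<sigma> ` std_triangle \<inter> \<tau> ` std_triangle = {\<sigma> (tri_vertex k)}) \<or>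
       (\<exists>k<3. \<exists>l<3. path_image (tri_edge \<sigma> k) = path_image (tri_edge \<tau> l) \<and>
          \<sigma> ` std_triangle \<inter> \<tau> ` std_triangle = path_image (tri_edge \<sigma> k))) \<and>
    (\<forall>\<sigma>\<in>P. \<forall>\<tau>\<in>P. \<forall>k<3. \<forall>l<3. \<sigma> \<noteq> \<tau> \<and> path_image (tri_edge \<sigma> k) = path_image (tri_edge \<tau> l) \<longrightarrow>
       pathstart (tri_edge \<sigma> k) = pathfinish (tri_edge \<tau> l) \<and>
       pathfinish (tri_edge \<sigma> k) = pathstart (tri_edge \<tau> l))"

text \<open>The boundary of a triangulated surface consists of the edges that belong to just one
  triangle.\<close>

definition boundary_edges :: "(real \<times> real \<Rightarrow> bicomplex) set \<Rightarrow> (real \<Rightarrow> bicomplex) set"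
  where "boundary_edges P =
    {tri_edge \<sigma> k | \<sigma> k. \<sigma> \<in> P \<and> k < 3 \<and>
       (\<forall>\<tau>\<in>P. \<forall>l<3. path_image (tri_edge \<tau> l) = path_image (tri_edge \<sigma> k) \<longrightarrow> \<tau> = \<sigma>)}"

definition topological_surface :: "bicomplex set \<Rightarrow> bool"
  where "topological_surface S \<longleftrightarrow>
    (\<forall>x\<in>S. \<exists>U V. x \<in> U \<and> openin (top_of_set S) U \<and>
       openin (top_of_set {z :: real \<times> real. 0 \<le> snd z}) V \<and> U homeomorphic V)"

text \<open>\<open>\<gamma>\<close> is a closed curve running once through the whole boundary, and through each boundary edge
  in the direction induced by the orientation. The starting point of \<open>\<gamma>\<close> is then a vertex; this
  is no restriction, as the triangulation can be subdivided.\<close>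

definition traverses_boundary ::
    "(real \<Rightarrow> bicomplex) \<Rightarrow> real \<Rightarrow> real \<Rightarrow> (real \<times> real \<Rightarrow> bicomplex) set \<Rightarrow> bool"
  where "traverses_boundary \<gamma> r s P \<longleftrightarrow>
    \<gamma> r = \<gamma> s \<and> inj_on \<gamma> {r..<s} \<and>
    \<gamma> ` {r..s} = (\<Union>e\<in>boundary_edges P. path_image e) \<and>
    (\<forall>e\<in>boundary_edges P. \<exists>u v. r \<le> u \<and> u < v \<and> v \<le> s \<and>
       \<gamma> ` {u..v} = path_image e \<and> \<gamma> u = pathstart e \<and> \<gamma> v = pathfinish e)"

definition bounds_orientable_surface ::
    "(real \<Rightarrow> bicomplex) \<Rightarrow> real \<Rightarrow> real \<Rightarrow> bicomplex set \<Rightarrow> bool"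
  where "bounds_orientable_surface \<gamma> r s S \<longleftrightarrow>
    topological_surface S \<and>
    (\<exists>P. oriented_triangulation P S \<and> traverses_boundary \<gamma> r s P)"

end

(* In the coordinates u = a + i b, v = a - i b the product is componentwise and the singular numbers
   are those with u v = 0. Differentiability along nonsingular increments makes the u-coordinate of
   psi locally a holomorphic function of u alone, and likewise for v, so psi has a primitive on a
   small ball about each point of G. Along an injective curved triangle these local primitives can
   be glued to one function, hence the integrals over the three sides add up to 0. Summing over all
   triangles, the sides shared by two of them cancel by coherence of the orientations, while the
   remaining ones tile the parameter interval of the boundary curve. *)

theory Submission
  imports Defs "HOL-Complex_Analysis.Cauchy_Integral_Theorem"
begin

subsection \<open>Local primitives of holomorphic bicomplex functions\<close>

text \<open>The derivative is a limit over nonsingular increments only, so even continuity of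
  \<open>\<psi>\<close> is not immediate, and nothing is assumed about regularity of the derivative.
  Integrating a closed form over the surface by Stokes is therefore no starting point; after the
  passage to functions of one complex variable, Cauchy-Goursat theory supplies the regularity. A
  primitive need not exist on all of \<open>G\<close>, nor on the whole surface, which may fail to
  be simply connected. Primitives are therefore built for one triangle at a time, and those of
  neighbouring triangles differ by constants on the common side. They are functions of points of B,
  not of parameters in \<open>std_triangle\<close>: \<open>\<Gamma>\<close> may run through an edge
  in a parametrization unrelated to that of the triangle, and only the values of the primitive at
  the endpoints should matter.\<close>

definition bc_coord :: "complex \<Rightarrow> bicomplex \<Rightarrow> complex"
  where "bc_coord c p = fst p + c * snd p"

lemma bounded_linear_bc_coord: "bounded_linear (bc_coord c)"
  unfolding bc_coord_def
  by (intro bounded_linear_add bounded_linear_fst bounded_linear_const_mult bounded_linear_snd)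

lemma bc_coord_add: "bc_coord c (p + q) = bc_coord c p + bc_coord c q"
  and bc_coord_diff: "bc_coord c (p - q) = bc_coord c p - bc_coord c q"
  by (simp_all add: bc_coord_def algebra_simps)

lemma bc_coord_complex: "bc_coord c (w, 0) = w"
  by (simp add: bc_coord_def)

text \<open>Only \<open>c\<^sup>2 = -1\<close> enters, so results stated for an arbitrary such
  \<open>c\<close> serve both coordinates \<open>c = \<i>\<close> and \<open>c = - \<i>\<close> at
  once.\<close>

lemma bc_coord_mult:
  assumes "c\<^sup>2 = -1"
  shows "bc_coord c (p \<odot> q) = bc_coord c p * bc_coord c q"
  using assms unfolding bc_coord_def bc_mult_def fst_conv snd_conv by algebra

lemma bc_singular_iff_bc_coord:
  assumes "c\<^sup>2 = -1"
  shows "bc_singular p \<longleftrightarrow> bc_coord c p = 0 \<or> bc_coord (- c) p = 0"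
proof -
  have "(fst p)\<^sup>2 + (snd p)\<^sup>2 = bc_coord c p * bc_coord (- c) p"
    using assms unfolding bc_coord_def by algebra
  then show ?thesis
    by (simp add: bc_singular_def)
qed

lemma bc_divide_mult_cancel:
  assumes "\<not> bc_singular q"
  shows "bc_divide p q \<odot> q = p"
proof -
  obtain a b where p: "p = (a, b)" by force
  obtain x y where q: "q = (x, y)" by force
  have nz: "x\<^sup>2 + y\<^sup>2 \<noteq> 0"
    using assms by (simp add: bc_singular_def q)
  \<comment> \<open>Naming the reciprocal turns both component equations into polynomial
    consequences of \<open>n * (x\<^sup>2 + y\<^sup>2) = 1\<close>.\<close>
  define n where "n = inverse (x\<^sup>2 + y\<^sup>2)"
  have n: "n * (x\<^sup>2 + y\<^sup>2) = 1"
    using nz by (simp add: n_def)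
  have "(a * (x * n) - b * (- y * n)) * x - (b * (x * n) + a * (- y * n)) * y = a"
       "(b * (x * n) + a * (- y * n)) * x + (a * (x * n) - b * (- y * n)) * y = b"
    using n by algebra+
  then show ?thesis
    by (simp add: bc_divide_def bc_mult_def bc_inverse_def p q divide_inverse n_def)
qed

lemma bc_coord_divide:
  assumes "c\<^sup>2 = -1" "\<not> bc_singular q"
  shows "bc_coord c (bc_divide p q) = bc_coord c p / bc_coord c q"
proof -
  have "bc_coord c (bc_divide p q) * bc_coord c q = bc_coord c p"
    using assms by (metis bc_coord_mult bc_divide_mult_cancel)
  moreover have "bc_coord c q \<noteq> 0"
    using assms by (auto simp: bc_singular_iff_bc_coord)
  ultimately show ?thesis
    by (simp add: field_simps)
qed

lemma has_bc_derivative_bc_coord: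
  assumes "c\<^sup>2 = -1" "has_bc_derivative \<psi> d p"
  shows "((\<lambda>h. (bc_coord c (\<psi> (p + h)) - bc_coord c (\<psi> p)) / bc_coord c h) \<longlongrightarrow> bc_coord c d)
           (at 0 within {h. \<not> bc_singular h})"
proof (rule Lim_transform_eventually)
  show "((\<lambda>h. bc_coord c (bc_divide (\<psi> (p + h) - \<psi> p) h)) \<longlongrightarrow> bc_coord c d)
          (at 0 within {h. \<not> bc_singular h})"
    using assms(2) unfolding has_bc_derivative_def
    by (rule bounded_linear.tendsto[OF bounded_linear_bc_coord])
  show "\<forall>\<^sub>F h in at 0 within {h. \<not> bc_singular h}.
          bc_coord c (bc_divide (\<psi> (p + h) - \<psi> p) h) =
          (bc_coord c (\<psi> (p + h)) - bc_coord c (\<psi> p)) / bc_coord c h"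
    using assms(1) by (auto simp: eventually_at_filter bc_coord_divide bc_coord_diff)
qed

text \<open>The point is that \<open>h\<close> is measured by \<open>bc_coord c h\<close> and not by
  its norm: if this coordinate tends to 0 while the other one stays away from 0, the c-coordinate of
  \<open>\<psi>\<close> still cannot change in the limit. Tolerance 1 in the limit gives the
  constant \<open>1 + norm (bc_coord c d)\<close>.\<close>

lemma has_bc_derivative_bc_coord_le:
  assumes "c\<^sup>2 = -1" "has_bc_derivative \<psi> d p"
  obtains e B where "e > 0" "B > 0"
    "\<And>h. norm h < e \<Longrightarrow> \<not> bc_singular h \<Longrightarrow>
       norm (bc_coord c (\<psi> (p + h)) - bc_coord c (\<psi> p)) \<le> B * norm (bc_coord c h)"
proof -
  obtain e where e: "e > 0" and *:
    "\<And>h. \<lbrakk>\<not> bc_singular h; h \<noteq> 0; dist h 0 < e\<rbrakk> \<Longrightarrow>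
       dist ((bc_coord c (\<psi> (p + h)) - bc_coord c (\<psi> p)) / bc_coord c h) (bc_coord c d) < 1"
    using has_bc_derivative_bc_coord[OF assms] unfolding Lim_within
    by (metis (no_types, lifting) dist_pos_lt mem_Collect_eq zero_less_one)
  show thesis
  proof (rule that[OF e])
    show "0 < 1 + norm (bc_coord c d)"
      by (smt (verit) norm_ge_zero)
  next
    fix h :: bicomplex
    assume h: "norm h < e" "\<not> bc_singular h"
    then have nz: "bc_coord c h \<noteq> 0" "h \<noteq> 0"
      using assms(1) by (auto simp: bc_singular_iff_bc_coord) (auto simp: bc_coord_def)
    let ?q = "(bc_coord c (\<psi> (p + h)) - bc_coord c (\<psi> p)) / bc_coord c h"
    have "norm ?q \<le> 1 + norm (bc_coord c d)"
      using *[of h] h nz norm_triangle_ineq2[of ?q "bc_coord c d"] by (simp add: dist_norm)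
    then have "norm ?q * norm (bc_coord c h) \<le> (1 + norm (bc_coord c d)) * norm (bc_coord c h)"
      by (intro mult_right_mono) auto
    then show "norm (bc_coord c (\<psi> (p + h)) - bc_coord c (\<psi> p)) \<le>
        (1 + norm (bc_coord c d)) * norm (bc_coord c h)"
      using nz by (simp add: norm_divide)
  qed
qed

text \<open>The derivative only sees nonsingular increments; a singular increment \<open>k\<close> is handled by
  approaching \<open>p + k\<close> both from \<open>p\<close> and from \<open>p + k\<close> itself along nonsingular ones.\<close>

lemma bc_holomorphic_bc_coord_locally_constant:
  assumes c: "c\<^sup>2 = -1" and hol: "bc_holomorphic_on \<psi> G" and p: "p \<in> G"
  obtains e where "e > 0"
    "\<And>k. p + k \<in> G \<Longrightarrow> norm k < e \<Longrightarrow> bc_coord c k = 0 \<Longrightarrow>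
       bc_coord c (\<psi> (p + k)) = bc_coord c (\<psi> p)"
proof -
  obtain d where "has_bc_derivative \<psi> d p"
    using hol p by (auto simp: bc_holomorphic_on_def)
  then obtain e B where e: "e > 0" and B: "B > 0" and bound:
    "\<And>h. norm h < e \<Longrightarrow> \<not> bc_singular h \<Longrightarrow>
       norm (bc_coord c (\<psi> (p + h)) - bc_coord c (\<psi> p)) \<le> B * norm (bc_coord c h)"
    using has_bc_derivative_bc_coord_le[OF c] by metis
  show thesis
  proof (rule that[OF e])
    fix k
    assume k: "p + k \<in> G" "norm k < e" "bc_coord c k = 0"
    obtain d' where "has_bc_derivative \<psi> d' (p + k)"
      using hol k by (auto simp: bc_holomorphic_on_def)
    then obtain e' B' where e': "e' > 0" and B': "B' > 0" and bound':
      "\<And>h. norm h < e' \<Longrightarrow> \<not> bc_singular h \<Longrightarrow>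
         norm (bc_coord c (\<psi> (p + k + h)) - bc_coord c (\<psi> (p + k))) \<le> B' * norm (bc_coord c h)"
      using has_bc_derivative_bc_coord_le[OF c] by metis
    \<comment> \<open>Both coordinates of \<open>(\<eta>, 0)\<close> equal \<open>\<eta>\<close>, so
      this increment is nonsingular for \<eta> > 0. As the c-coordinate of \<open>k\<close> is 0,
      that of \<open>k + ?h \<eta>\<close> is \<open>\<eta>\<close> too, and the other one vanishes
      for at most one value of \<open>\<eta>\<close>, which small \<open>\<eta>\<close> avoid. Both
      approaches then contribute only a multiple of \<open>\<eta>\<close>.\<close>
    let ?h = "\<lambda>\<eta>::real. (of_real \<eta> :: complex, 0 :: complex)"
    let ?n = "norm (bc_coord c (\<psi> (p + k)) - bc_coord c (\<psi> p))"
    have small: "\<forall>\<^sub>F \<eta> in at_right 0. \<eta> < x" if "x > 0" for x :: real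
      using that by (rule eventually_at_right_real[THEN eventually_mono]) auto
    have "\<forall>\<^sub>F \<eta>::real in at_right 0. of_real \<eta> \<noteq> - bc_coord (- c) k"
    proof (cases "bc_coord (- c) k = 0")
      case True
      then show ?thesis
        using eventually_at_right_less[of "0::real"] by (auto elim: eventually_mono)
    next
      case False
      then have "\<forall>\<^sub>F \<eta> in at_right 0. \<eta> < norm (bc_coord (- c) k)"
        by (intro small) auto
      then show ?thesis
        using eventually_at_right_less[of 0]
        by eventually_elim (auto dest: arg_cong[where f = norm])
    qed
    moreover have "\<forall>\<^sub>F \<eta> in at_right 0. \<eta> < e - norm k" "\<forall>\<^sub>F \<eta> in at_right 0. \<eta> < e'"
      using k e' by (auto intro: small)
    ultimately have "\<forall>\<^sub>F \<eta> in at_right 0. ?n \<le> (B + B') * \<eta>"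
      using eventually_at_right_less[of 0]
    proof eventually_elim
      case (elim \<eta>)
      have n: "norm (?h \<eta>) = \<eta>" and ch: "bc_coord c (?h \<eta>) = of_real \<eta>"
        using elim by (auto simp: norm_Pair bc_coord_def)
      have "\<not> bc_singular (k + ?h \<eta>)"
        using elim k(3) c by (auto simp: bc_singular_iff_bc_coord[of c] bc_coord_add bc_coord_complex
            add_eq_0_iff)
      moreover have "norm (k + ?h \<eta>) < e"
        using norm_triangle_ineq[of k "?h \<eta>"] n elim by linarith
      ultimately have 1: "norm (bc_coord c (\<psi> (p + (k + ?h \<eta>))) - bc_coord c (\<psi> p)) \<le> B * \<eta>"
        using bound[of "k + ?h \<eta>"] elim k(3) by (simp add: bc_coord_add ch)
      have "\<not> bc_singular (?h \<eta>)"
        using elim by (auto simp: bc_singular_def)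
      then have 2: "norm (bc_coord c (\<psi> (p + k + ?h \<eta>)) - bc_coord c (\<psi> (p + k))) \<le> B' * \<eta>"
        using bound'[of "?h \<eta>"] elim by (simp add: ch n)
      show ?case
        using 1 2 norm_triangle_ineq4[of
            "bc_coord c (\<psi> (p + k + ?h \<eta>)) - bc_coord c (\<psi> p)"
            "bc_coord c (\<psi> (p + k + ?h \<eta>)) - bc_coord c (\<psi> (p + k))"]
        by (simp add: algebra_simps)
    qed
    moreover have "((\<lambda>\<eta>. (B + B') * \<eta>) \<longlongrightarrow> (B + B') * 0) (at_right 0)"
      by (intro tendsto_intros)
    ultimately have "?n \<le> 0"
      by (intro tendsto_lowerbound[of _ "(B + B') * 0", simplified]) auto
    then show "bc_coord c (\<psi> (p + k)) = bc_coord c (\<psi> p)"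
      by simp
  qed
qed

text \<open>Points of \<open>U\<close> with a prescribed c-coordinate form a convex, hence
  connected, slice, on which the c-coordinate of \<open>\<psi>\<close> is locally constant.\<close>

lemma bc_holomorphic_bc_coord_cong:
  assumes c: "c\<^sup>2 = -1" and hol: "bc_holomorphic_on \<psi> G" and "convex U" "U \<subseteq> G"
    and pq: "p \<in> U" "q \<in> U" "bc_coord c p = bc_coord c q"
  shows "bc_coord c (\<psi> p) = bc_coord c (\<psi> q)"
proof -
  define A where "A = U \<inter> bc_coord c -` {bc_coord c p}"
  have "convex (bc_coord c -` {bc_coord c p})"
    by (intro convex_linear_vimage bounded_linear.linear bounded_linear_bc_coord) auto
  then have "connected A"
    unfolding A_def using \<open>convex U\<close> by (intro convex_connected convex_Int)
  moreover have "\<exists>T. openin (top_of_set A) T \<and> a \<in> T \<and>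
      (\<forall>x\<in>T. bc_coord c (\<psi> x) = bc_coord c (\<psi> a))" if a: "a \<in> A" for a
  proof -
    obtain e where e: "e > 0" "\<And>k. a + k \<in> G \<Longrightarrow> norm k < e \<Longrightarrow> bc_coord c k = 0 \<Longrightarrow>
       bc_coord c (\<psi> (a + k)) = bc_coord c (\<psi> a)"
      using bc_holomorphic_bc_coord_locally_constant[OF c hol, of a] a \<open>U \<subseteq> G\<close> A_def by blast
    have "bc_coord c (\<psi> x) = bc_coord c (\<psi> a)" if "x \<in> A \<inter> ball a e" for x
      using e(2)[of "x - a"] that a \<open>U \<subseteq> G\<close>
      by (auto simp: A_def bc_coord_diff dist_norm norm_minus_commute)
    moreover have "openin (top_of_set A) (A \<inter> ball a e)" "a \<in> A \<inter> ball a e"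
      using e(1) a by (auto intro: openin_open_Int)
    ultimately show ?thesis
      by blast
  qed
  ultimately have "(\<lambda>x. bc_coord c (\<psi> x)) constant_on A"
    by (rule locally_constant_imp_constant)
  moreover have "p \<in> A" "q \<in> A"
    using pq by (auto simp: A_def)
  ultimately show ?thesis
    by (auto simp: constant_on_def)
qed

lemma norm_bc_coord_le:
  assumes "c\<^sup>2 = -1"
  shows "norm (bc_coord c p) \<le> 2 * norm p"
proof -
  have "(norm c)\<^sup>2 = 1"
    using assms by (metis norm_minus_cancel norm_one norm_power)
  then have "norm c = 1"
    by (simp add: power2_eq_1_iff) (smt (verit) norm_ge_zero)
  then have "norm (bc_coord c p) \<le> norm (fst p) + norm (snd p)"
    unfolding bc_coord_def by (metis mult_1 norm_mult norm_triangle_ineq)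
  also have "\<dots> \<le> 2 * norm p"
    using norm_fst_le[of "fst p" "snd p"] norm_snd_le[of "snd p" "fst p"] by simp
  finally show ?thesis .
qed

text \<open>Along a complex line through \<open>p\<close> that \<open>bc_coord c\<close> maps
  bijectively to the plane, the c-coordinate of \<open>\<psi>\<close> is an ordinary holomorphic
  function and has a primitive on a disc. Constancy on the slices carries the result from the line
  to a whole ball.\<close>

lemma bc_holomorphic_bc_coord_primitive:
  assumes c: "c\<^sup>2 = -1" and hol: "bc_holomorphic_on \<psi> G" and "open G" "p \<in> G"
  obtains e \<Phi> where "e > 0"
    "\<And>q. q \<in> ball p e \<Longrightarrow> (\<Phi> has_field_derivative bc_coord c (\<psi> q)) (at (bc_coord c q))"
proof -
  obtain R where R: "R > 0" "ball p R \<subseteq> G"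
    using assms by (metis open_contains_ball)
  define w0 where "w0 = bc_coord c p"
  \<comment> \<open>A section of \<open>bc_coord c\<close> through \<open>p\<close>. Its increments
    have the form \<open>(h, 0)\<close>, so they are nonsingular unless they are 0.\<close>
  define s where "s w = p + (w - w0, 0)" for w
  have cs: "bc_coord c (s w) = w" for w
    by (simp add: s_def bc_coord_add bc_coord_complex w0_def)
  have s_ball: "s w \<in> ball p R" if "w \<in> ball w0 R" for w
    using that by (simp add: s_def dist_norm norm_Pair norm_minus_commute)
  define F where "F w = bc_coord c (\<psi> (s w))" for w
  have "F field_differentiable at w" if "w \<in> ball w0 R" for w
  proof -
    have "s w \<in> G"
      using that s_ball R by blast
    then obtain d where d: "has_bc_derivative \<psi> d (s w)"
      using hol by (auto simp: bc_holomorphic_on_def)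
    have "filterlim (\<lambda>h. (h, 0)) (at 0 within {h. \<not> bc_singular h}) (at (0::complex))"
      unfolding filterlim_at
    proof
      show "((\<lambda>h. (h, 0)) \<longlongrightarrow> (0 :: bicomplex)) (at (0::complex))"
        unfolding zero_prod_def by (intro tendsto_intros)
      show "\<forall>\<^sub>F h in at (0::complex). (h, 0) \<in> {h. \<not> bc_singular h} \<and> (h, 0) \<noteq> (0 :: bicomplex)"
        by (auto simp: eventually_at_filter bc_singular_def zero_prod_def)
    qed
    from filterlim_compose[OF has_bc_derivative_bc_coord[OF c d] this]
    have "((\<lambda>h. (F (w + h) - F w) / h) \<longlongrightarrow> bc_coord c d) (at 0)"
      by (simp add: F_def bc_coord_complex s_def algebra_simps)
    then show ?thesis
      unfolding field_differentiable_def DERIV_def by blast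
  qed
  then have "F holomorphic_on ball w0 R"
    by (auto simp: holomorphic_on_def field_differentiable_at_within)
  then obtain \<Phi> where \<Phi>:
    "\<And>w. w \<in> ball w0 R \<Longrightarrow> (\<Phi> has_field_derivative F w) (at w within ball w0 R)"
    using holomorphic_convex_primitive'[of "ball w0 R" F] by auto
  \<comment> \<open>The radius is halved because \<open>bc_coord c\<close> may enlarge distances,
    but at most by the factor 2.\<close>
  show thesis
  proof (rule that[of "R / 2" \<Phi>])
    show "R / 2 > 0"
      using R by simp
  next
    fix q
    assume q: "q \<in> ball p (R / 2)"
    have "norm (bc_coord c (q - p)) \<le> 2 * norm (q - p)"
      by (rule norm_bc_coord_le[OF c])
    then have w: "bc_coord c q \<in> ball w0 R"
      using q by (simp add: bc_coord_diff w0_def dist_norm norm_minus_commute)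
    have "bc_coord c (\<psi> (s (bc_coord c q))) = bc_coord c (\<psi> q)"
      using q R s_ball[OF w] by (intro bc_holomorphic_bc_coord_cong[OF c hol, of "ball p R"]) (auto simp: cs)
    then show "(\<Phi> has_field_derivative bc_coord c (\<psi> q)) (at (bc_coord c q))"
      using \<Phi>[OF w] unfolding F_def at_within_open[OF w open_ball] by argo
  qed
qed

text \<open>This is the full real derivative, singular increments included, since the chain rule
  along a curve must allow every tangent direction.\<close>

definition bc_primitive_on :: "(bicomplex \<Rightarrow> bicomplex) \<Rightarrow> bicomplex set \<Rightarrow> (bicomplex \<Rightarrow> bicomplex) \<Rightarrow> bool"
  where "bc_primitive_on \<psi> U \<Psi> \<longleftrightarrow> (\<forall>q\<in>U. (\<Psi> has_derivative (\<lambda>h. \<psi> q \<odot> h)) (at q))"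

lemma bc_primitive_on_subset: "bc_primitive_on \<psi> U \<Psi> \<Longrightarrow> V \<subseteq> U \<Longrightarrow> bc_primitive_on \<psi> V \<Psi>"
  by (auto simp: bc_primitive_on_def)

lemma bc_holomorphic_local_primitive:
  assumes hol: "bc_holomorphic_on \<psi> G" and "open G" "p \<in> G"
  obtains e \<Psi> where "e > 0" "bc_primitive_on \<psi> (ball p e) \<Psi>"
proof -
  have i: "\<i>\<^sup>2 = (-1::complex)" "(- \<i>)\<^sup>2 = (-1::complex)"
    by (simp_all add: power2_eq_square)
  obtain e1 \<Phi>1 where 1: "e1 > 0"
    "\<And>q. q \<in> ball p e1 \<Longrightarrow> (\<Phi>1 has_field_derivative bc_coord \<i> (\<psi> q)) (at (bc_coord \<i> q))"
    using bc_holomorphic_bc_coord_primitive[OF i(1) assms] by blast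
  obtain e2 \<Phi>2 where 2: "e2 > 0"
    "\<And>q. q \<in> ball p e2 \<Longrightarrow> (\<Phi>2 has_field_derivative bc_coord (- \<i>) (\<psi> q)) (at (bc_coord (- \<i>) q))"
    using bc_holomorphic_bc_coord_primitive[OF i(2) assms] by blast
  \<comment> \<open>Inverts the change of coordinates: from u = a + i b and v = a - i b one recovers
    a = (u + v) / 2 and b = (u - v) / (2 i).\<close>
  define \<Psi> where "\<Psi> q = ((\<Phi>1 (bc_coord \<i> q) + \<Phi>2 (bc_coord (- \<i>) q)) / 2,
      (\<Phi>1 (bc_coord \<i> q) - \<Phi>2 (bc_coord (- \<i>) q)) / (2 * \<i>))" for q
  have "(\<Psi> has_derivative (\<lambda>h. \<psi> q \<odot> h)) (at q)" if q: "q \<in> ball p (min e1 e2)" for q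
  proof -
    have q1: "q \<in> ball p e1" and q2: "q \<in> ball p e2"
      using q by auto
    have d1: "((\<lambda>q. \<Phi>1 (bc_coord \<i> q)) has_derivative (\<lambda>h. bc_coord \<i> (\<psi> q) * bc_coord \<i> h)) (at q)"
      by (rule has_derivative_compose[OF bounded_linear_imp_has_derivative[OF
              bounded_linear_bc_coord] 1(2)[OF q1, unfolded has_field_derivative_def]])
    have d2: "((\<lambda>q. \<Phi>2 (bc_coord (- \<i>) q)) has_derivative
        (\<lambda>h. bc_coord (- \<i>) (\<psi> q) * bc_coord (- \<i>) h)) (at q)"
      by (rule has_derivative_compose[OF bounded_linear_imp_has_derivative[OF
              bounded_linear_bc_coord] 2(2)[OF q2, unfolded has_field_derivative_def]])
    have "((\<lambda>h. ((bc_coord \<i> (\<psi> q) * bc_coord \<i> h + bc_coord (- \<i>) (\<psi> q) * bc_coord (- \<i>) h) / 2,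
        (bc_coord \<i> (\<psi> q) * bc_coord \<i> h - bc_coord (- \<i>) (\<psi> q) * bc_coord (- \<i>) h) / (2 * \<i>)))) =
        (\<lambda>h. \<psi> q \<odot> h)"
      by (rule ext) (simp add: bc_coord_def bc_mult_def field_simps)
    moreover have "(\<Psi> has_derivative
       (\<lambda>h. ((bc_coord \<i> (\<psi> q) * bc_coord \<i> h + bc_coord (- \<i>) (\<psi> q) * bc_coord (- \<i>) h) / 2,
        (bc_coord \<i> (\<psi> q) * bc_coord \<i> h - bc_coord (- \<i>) (\<psi> q) * bc_coord (- \<i>) h) / (2 * \<i>)))) (at q)"
      unfolding \<Psi>_def
      by (intro has_derivative_Pair bounded_linear.has_derivative[OF bounded_linear_divide]
          has_derivative_add has_derivative_diff d1 d2)
    ultimately show ?thesis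
      by simp
  qed
  then show thesis
    using that[of "min e1 e2" \<Psi>] 1 2 by (auto simp: bc_primitive_on_def)
qed

subsection \<open>Gluing local primitives\<close>

lemma bc_primitive_on_add_const: "bc_primitive_on \<psi> U \<Psi> \<Longrightarrow> bc_primitive_on \<psi> U (\<lambda>q. \<Psi> q + c)"
  by (auto simp: bc_primitive_on_def intro!: derivative_eq_intros)

lemma bc_primitive_on_unique:
  assumes "convex U" "bc_primitive_on \<psi> U \<Psi>1" "bc_primitive_on \<psi> U \<Psi>2"
  obtains c where "\<And>q. q \<in> U \<Longrightarrow> \<Psi>1 q = \<Psi>2 q + c"
proof -
  have "((\<lambda>q. \<Psi>1 q - \<Psi>2 q) has_derivative (\<lambda>h. 0)) (at q within U)" if "q \<in> U" for q
  proof -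
    have "((\<lambda>q. \<Psi>1 q - \<Psi>2 q) has_derivative (\<lambda>h. \<psi> q \<odot> h - \<psi> q \<odot> h)) (at q)"
      using assms that by (intro has_derivative_diff) (auto simp: bc_primitive_on_def)
    then show ?thesis
      by (simp add: has_derivative_at_withinI)
  qed
  then obtain c where "\<forall>q\<in>U. \<Psi>1 q - \<Psi>2 q = c"
    using has_derivative_zero_constant[OF \<open>convex U\<close>] by blast
  then show thesis
    using that[of c] by (metis add.commute diff_add_cancel)
qed

text \<open>The set \<open>A\<close> will be a curved triangle or a side of one and has no interior
  to differentiate in, so \<open>g\<close> is tied to primitives on balls of the ambient space with
  which it agrees on \<open>A\<close>.\<close>

definition local_primitive_on ::
    "(bicomplex \<Rightarrow> bicomplex) \<Rightarrow> bicomplex set \<Rightarrow> (bicomplex \<Rightarrow> bicomplex) \<Rightarrow> bool"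
  where "local_primitive_on \<psi> A g \<longleftrightarrow>
    (\<forall>p\<in>A. \<exists>e>0. \<exists>\<Psi>. bc_primitive_on \<psi> (ball p e) \<Psi> \<and> (\<forall>q\<in>A \<inter> ball p e. g q = \<Psi> q))"

lemma local_primitive_onE:
  assumes "local_primitive_on \<psi> A g" "p \<in> A"
  obtains e \<Psi> where "e > 0" "bc_primitive_on \<psi> (ball p e) \<Psi>"
    "\<And>q. q \<in> A \<Longrightarrow> q \<in> ball p e \<Longrightarrow> g q = \<Psi> q"
  using assms unfolding local_primitive_on_def by blast

lemma local_primitive_on_subset:
  assumes "local_primitive_on \<psi> A g" "B \<subseteq> A"
  shows "local_primitive_on \<psi> B g"
  unfolding local_primitive_on_def
proof
  fix p
  assume "p \<in> B"
  with assms obtain e \<Psi> where "e > 0" "bc_primitive_on \<psi> (ball p e) \<Psi>"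
    and *: "\<forall>q\<in>A \<inter> ball p e. g q = \<Psi> q"
    unfolding local_primitive_on_def by (meson subsetD)
  moreover from * have "\<forall>q\<in>B \<inter> ball p e. g q = \<Psi> q"
    using assms(2) by auto
  ultimately show "\<exists>e>0. \<exists>\<Psi>. bc_primitive_on \<psi> (ball p e) \<Psi> \<and> (\<forall>q\<in>B \<inter> ball p e. g q = \<Psi> q)"
    by metis
qed

lemma bc_primitive_imp_local_primitive_on:
  assumes "bc_primitive_on \<psi> U \<Psi>" "open U" "A \<subseteq> U"
  shows "local_primitive_on \<psi> A \<Psi>"
  unfolding local_primitive_on_def
proof
  fix p
  assume "p \<in> A"
  then obtain e where "e > 0" "ball p e \<subseteq> U"
    using assms by (meson open_contains_ball subset_iff)
  then show "\<exists>e>0. \<exists>\<Psi>'. bc_primitive_on \<psi> (ball p e) \<Psi>' \<and> (\<forall>q\<in>A \<inter> ball p e. \<Psi> q = \<Psi>' q)"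
    using bc_primitive_on_subset[OF assms(1)] by blast
qed

lemma local_primitive_on_unique:
  assumes A: "connected A" and g1: "local_primitive_on \<psi> A g1" and g2: "local_primitive_on \<psi> A g2"
  obtains c where "\<And>p. p \<in> A \<Longrightarrow> g1 p = g2 p + c"
proof -
  have "\<exists>T. openin (top_of_set A) T \<and> a \<in> T \<and> (\<forall>x\<in>T. g1 x - g2 x = g1 a - g2 a)"
    if a: "a \<in> A" for a
  proof -
    obtain e1 \<Psi>1 where 1: "e1 > 0" "bc_primitive_on \<psi> (ball a e1) \<Psi>1"
      "\<And>q. q \<in> A \<Longrightarrow> q \<in> ball a e1 \<Longrightarrow> g1 q = \<Psi>1 q"
      using local_primitive_onE[OF g1 a] by metis
    obtain e2 \<Psi>2 where 2: "e2 > 0" "bc_primitive_on \<psi> (ball a e2) \<Psi>2"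
      "\<And>q. q \<in> A \<Longrightarrow> q \<in> ball a e2 \<Longrightarrow> g2 q = \<Psi>2 q"
      using local_primitive_onE[OF g2 a] by metis
    define e where "e = min e1 e2"
    have e: "e > 0" "ball a e \<subseteq> ball a e1" "ball a e \<subseteq> ball a e2"
      using 1 2 by (auto simp: e_def)
    obtain c where c: "\<And>q. q \<in> ball a e \<Longrightarrow> \<Psi>1 q = \<Psi>2 q + c"
      using bc_primitive_on_unique[OF convex_ball, of \<psi> a e \<Psi>1 \<Psi>2]
        bc_primitive_on_subset[OF 1(2) e(2)] bc_primitive_on_subset[OF 2(2) e(3)] by metis
    have "g1 x - g2 x = c" if "x \<in> A \<inter> ball a e" for x
    proof -
      have "x \<in> A" "x \<in> ball a e1" "x \<in> ball a e2" "x \<in> ball a e"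
        using that e by blast+
      then show ?thesis
        using 1(3) 2(3) c by simp
    qed
    moreover have "a \<in> A \<inter> ball a e" "openin (top_of_set A) (A \<inter> ball a e)"
      using e a by (auto intro: openin_open_Int)
    ultimately show ?thesis
      by metis
  qed
  then have "(\<lambda>x. g1 x - g2 x) constant_on A"
    by (rule locally_constant_imp_constant[OF A])
  then obtain c where "\<And>p. p \<in> A \<Longrightarrow> g1 p - g2 p = c"
    unfolding constant_on_def by blast
  then show thesis
    using that[of c] by (metis add.commute diff_add_cancel)
qed

text \<open>A connected overlap makes the difference of \<open>g1\<close> and \<open>g2\<close> a
  single constant, by which \<open>g2\<close> can be shifted. Closedness ensures that a point in
  only one of the sets has a ball disjoint from the other.\<close>

lemma local_primitive_on_Un:
  assumes g1: "local_primitive_on \<psi> A g1" and g2: "local_primitive_on \<psi> B g2"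
    and clo: "closed A" "closed B" and con: "connected (A \<inter> B)"
  shows "\<exists>g. local_primitive_on \<psi> (A \<union> B) g"
proof -
  obtain c where c: "\<And>p. p \<in> A \<Longrightarrow> p \<in> B \<Longrightarrow> g1 p = g2 p + c"
    using local_primitive_on_unique[OF con local_primitive_on_subset[OF g1 Int_lower1]
        local_primitive_on_subset[OF g2 Int_lower2]]
    by (metis IntI)
  define g where "g p = (if p \<in> A then g1 p else g2 p + c)" for p
  have gA: "g p = g1 p" if "p \<in> A" for p
    using that by (simp add: g_def)
  have gB: "g p = g2 p + c" if "p \<in> B" for p
    using that c by (simp add: g_def)
  have "\<exists>e>0. \<exists>\<Psi>. bc_primitive_on \<psi> (ball p e) \<Psi> \<and> (\<forall>q\<in>(A \<union> B) \<inter> ball p e. g q = \<Psi> q)"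
    if p: "p \<in> A \<union> B" for p
  proof -
    have avoid: "\<exists>e>0. ball p e \<inter> C = {}" if "closed C" "p \<notin> C" for C
      using that open_contains_ball[of "- C"] by (auto simp: open_closed disjoint_eq_subset_Compl)
    consider "p \<in> A" "p \<in> B" | "p \<in> A" "p \<notin> B" | "p \<notin> A" "p \<in> B"
      using p by blast
    then show ?thesis
    proof cases
      case 1
      obtain e1 \<Psi>1 where 1: "e1 > 0" "bc_primitive_on \<psi> (ball p e1) \<Psi>1"
        "\<And>q. q \<in> A \<Longrightarrow> q \<in> ball p e1 \<Longrightarrow> g1 q = \<Psi>1 q"
        using local_primitive_onE[OF g1 \<open>p \<in> A\<close>] by metis
      obtain e2 \<Psi>2 where 2: "e2 > 0" "bc_primitive_on \<psi> (ball p e2) \<Psi>2"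
        "\<And>q. q \<in> B \<Longrightarrow> q \<in> ball p e2 \<Longrightarrow> g2 q = \<Psi>2 q"
        using local_primitive_onE[OF g2 \<open>p \<in> B\<close>] by metis
      define e where "e = min e1 e2"
      have e: "e > 0" "ball p e \<subseteq> ball p e1" "ball p e \<subseteq> ball p e2"
        using 1 2 by (auto simp: e_def)
      \<comment> \<open>The two ambient primitives differ by a constant on the ball, and evaluating
        at \<open>p\<close> identifies it with the global \<open>c\<close>. Hence
        \<open>\<Psi>1\<close> alone represents \<open>g\<close> on both sets near
        \<open>p\<close>.\<close>
      obtain c' where c': "\<And>q. q \<in> ball p e \<Longrightarrow> \<Psi>1 q = \<Psi>2 q + c'"
        using bc_primitive_on_unique[OF convex_ball, of \<psi> p e \<Psi>1 \<Psi>2]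
          bc_primitive_on_subset[OF 1(2) e(2)] bc_primitive_on_subset[OF 2(2) e(3)] by metis
      have "\<Psi>1 p = g1 p" "\<Psi>2 p = g2 p"
        using 1 2 \<open>p \<in> A\<close> \<open>p \<in> B\<close> by auto
      then have "c' = c"
        using c'[of p] c[of p] e(1) \<open>p \<in> A\<close> \<open>p \<in> B\<close> by simp
      have "g q = \<Psi>1 q" if q: "q \<in> (A \<union> B) \<inter> ball p e" for q
      proof (cases "q \<in> A")
        case True
        then show ?thesis
          using q e 1(3)[of q] gA by auto
      next
        case False
        then have "g q = \<Psi>2 q + c"
          using q e 2(3)[of q] gB by auto
        then show ?thesis
          using c'[of q] q \<open>c' = c\<close> by auto
      qed
      then show ?thesis
        using e bc_primitive_on_subset[OF 1(2) e(2)] by blast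
    next
      case 2
      obtain e1 \<Psi>1 where 1: "e1 > 0" "bc_primitive_on \<psi> (ball p e1) \<Psi>1"
        "\<And>q. q \<in> A \<Longrightarrow> q \<in> ball p e1 \<Longrightarrow> g1 q = \<Psi>1 q"
        using local_primitive_onE[OF g1 \<open>p \<in> A\<close>] by metis
      obtain e2 where e2: "e2 > 0" "ball p e2 \<inter> B = {}"
        using avoid[OF clo(2) 2(2)] by blast
      have sub: "ball p (min e1 e2) \<subseteq> ball p e1" "ball p (min e1 e2) \<subseteq> ball p e2"
        by auto
      have "g q = \<Psi>1 q" if "q \<in> (A \<union> B) \<inter> ball p (min e1 e2)" for q
      proof -
        have "q \<in> A" "q \<in> ball p e1"
          using that sub e2 by blast+
        then show ?thesis
          using 1(3) gA by simp
      qed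
      moreover have "min e1 e2 > 0"
        using 1 e2 by simp
      ultimately show ?thesis
        using bc_primitive_on_subset[OF 1(2) sub(1)] by blast
    next
      case 3
      obtain e1 \<Psi>2 where 1: "e1 > 0" "bc_primitive_on \<psi> (ball p e1) \<Psi>2"
        "\<And>q. q \<in> B \<Longrightarrow> q \<in> ball p e1 \<Longrightarrow> g2 q = \<Psi>2 q"
        using local_primitive_onE[OF g2 \<open>p \<in> B\<close>] by metis
      obtain e2 where e2: "e2 > 0" "ball p e2 \<inter> A = {}"
        using avoid[OF clo(1) 3(1)] by blast
      have sub: "ball p (min e1 e2) \<subseteq> ball p e1" "ball p (min e1 e2) \<subseteq> ball p e2"
        by auto
      have "g q = \<Psi>2 q + c" if "q \<in> (A \<union> B) \<inter> ball p (min e1 e2)" for q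
      proof -
        have "q \<in> B" "q \<in> ball p e1"
          using that sub e2 by blast+
        then show ?thesis
          using 1(3) gB by simp
      qed
      moreover have "min e1 e2 > 0"
        using 1 e2 by simp
      ultimately show ?thesis
        using bc_primitive_on_add_const[OF bc_primitive_on_subset[OF 1(2) sub(1)], of c] by blast
    qed
  qed
  then show ?thesis
    unfolding local_primitive_on_def by blast
qed

text \<open>Pieces of \<open>K\<close> cut out by rectangles are convex and so are their
  intersections. Injectivity of \<open>\<sigma>\<close> turns the intersection of two images into
  the image of the intersection, which is connected, as gluing demands.\<close>

lemma local_primitive_on_convex_image:
  fixes \<sigma> :: "real \<times> real \<Rightarrow> bicomplex"
  assumes hol: "bc_holomorphic_on \<psi> G" and "open G"
    and K: "compact K" "convex K"
    and \<sigma>: "continuous_on K \<sigma>" "inj_on \<sigma> K" "\<sigma> ` K \<subseteq> G"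
  obtains g where "local_primitive_on \<psi> (\<sigma> ` K) g"
proof -
  define P where "P X \<longleftrightarrow> (\<exists>g. local_primitive_on \<psi> (\<sigma> ` X) g)" for X
  define \<B> where "\<B> = {U. open U \<and> (\<exists>\<Psi>. bc_primitive_on \<psi> U \<Psi>)}"
  have "\<sigma> ` K \<subseteq> \<Union>\<B>"
  proof
    fix p
    assume "p \<in> \<sigma> ` K"
    then obtain e \<Psi> where "e > 0" "bc_primitive_on \<psi> (ball p e) \<Psi>"
      using bc_holomorphic_local_primitive[OF hol \<open>open G\<close>, of p] \<sigma> by blast
    then show "p \<in> \<Union>\<B>"
      by (auto simp: \<B>_def intro!: exI[of _ "ball p e"])
  qed
  moreover have "open U" if "U \<in> \<B>" for U
    using that by (simp add: \<B>_def)
  \<comment> \<open>A Lebesgue number for the cover by domains of primitives; uniform continuity of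
    \<open>\<sigma>\<close> then converts it into a scale \<open>\<delta>\<close> in the parameter
    domain.\<close>
  ultimately obtain \<epsilon> where \<epsilon>: "\<epsilon> > 0" "\<And>p. p \<in> \<sigma> ` K \<Longrightarrow> \<exists>U\<in>\<B>. ball p \<epsilon> \<subseteq> U"
    using Heine_Borel_lemma[OF compact_continuous_image[OF \<sigma>(1) K(1)], of \<B>] by blast
  obtain \<delta> where \<delta>: "\<delta> > 0"
    "\<And>x y. x \<in> K \<Longrightarrow> y \<in> K \<Longrightarrow> dist x y < \<delta> \<Longrightarrow> dist (\<sigma> x) (\<sigma> y) < \<epsilon>"
    using compact_uniformly_continuous[OF \<sigma>(1) K(1)] \<epsilon>(1) unfolding uniformly_continuous_on_def
    by metis
  have small: "P X" if X: "X \<subseteq> K" "\<And>x y. x \<in> X \<Longrightarrow> y \<in> X \<Longrightarrow> dist x y < \<delta>" for X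
  proof (cases "X = {}")
    case True
    then show ?thesis
      by (auto simp: P_def local_primitive_on_def)
  next
    case False
    then obtain x where x: "x \<in> X"
      by blast
    obtain U \<Psi> where U: "open U" "bc_primitive_on \<psi> U \<Psi>" "ball (\<sigma> x) \<epsilon> \<subseteq> U"
      using \<epsilon>(2)[of "\<sigma> x"] x X by (auto simp: \<B>_def)
    have "\<sigma> ` X \<subseteq> ball (\<sigma> x) \<epsilon>"
    proof
      fix p
      assume "p \<in> \<sigma> ` X"
      then obtain y where "y \<in> X" "p = \<sigma> y"
        by blast
      then show "p \<in> ball (\<sigma> x) \<epsilon>"
        using \<delta>(2)[of x y] X x by (auto simp del: split_paired_All)
    qed
    then show ?thesis
      unfolding P_def using bc_primitive_imp_local_primitive_on[OF U(2,1)] U(3) by blast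
  qed
  have glue: "P (X \<union> Y)" if XY: "P X" "P Y" "X \<subseteq> K" "Y \<subseteq> K" "compact X" "compact Y" "convex X" "convex Y"
    for X Y
  proof -
    have cl: "closed (\<sigma> ` X)" "closed (\<sigma> ` Y)"
      using XY by (intro compact_imp_closed compact_continuous_image continuous_on_subset[OF \<sigma>(1)]; simp)+
    have "connected (\<sigma> ` (X \<inter> Y))"
      using XY by (intro connected_continuous_image continuous_on_subset[OF \<sigma>(1)]
          convex_connected convex_Int) auto
    then have "connected (\<sigma> ` X \<inter> \<sigma> ` Y)"
      using inj_on_image_Int[OF \<sigma>(2)] XY by metis
    then show ?thesis
      using local_primitive_on_Un[OF _ _ cl] XY unfolding P_def image_Un by blast
  qed
  let ?R = "\<lambda>a b c d. K \<inter> {a..b} \<times> {c..d}"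
  have rect: "?R a b c d \<subseteq> K" "compact (?R a b c d)" "convex (?R a b c d)" for a b c d
    using K by (simp_all add: compact_Times compact_Int convex_Int convex_Times)
  \<comment> \<open>Bisection of the second coordinate inside a narrow strip. Sides below
    \<open>\<delta> / 2\<close> suffice, because the product distance is at most the sum of the
    coordinate distances.\<close>
  have tall: "P (?R a b c d)" if "c \<le> d" "b - a < \<delta> / 2" for a b c d
  proof (rule Bolzano[where P = "\<lambda>x y. P (?R a b x y)"])
    show "c \<le> d"
      by fact
  next
    fix x y z
    assume "P (?R a b x y)" "P (?R a b y z)" "x \<le> y" "y \<le> z"
    moreover from this have "?R a b x z = ?R a b x y \<union> ?R a b y z"
      by auto
    ultimately show "P (?R a b x z)"
      using glue[of "?R a b x y" "?R a b y z"] rect by simp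
  next
    fix x
    have loc: "P (?R a b c' d')" if "d' - c' < \<delta> / 2" for c' d'
    proof (rule small)
      fix v w
      assume "v \<in> ?R a b c' d'" "w \<in> ?R a b c' d'"
      then have "fst v \<in> {a..b}" "fst w \<in> {a..b}" "snd v \<in> {c'..d'}" "snd w \<in> {c'..d'}"
        by auto
      then have "dist (fst v) (fst w) < \<delta> / 2" "dist (snd v) (snd w) < \<delta> / 2"
        using that \<open>b - a < \<delta> / 2\<close> unfolding dist_real_def atLeastAtMost_iff by linarith+
      moreover have "dist v w \<le> dist (fst v) (fst w) + dist (snd v) (snd w)"
        by (simp add: dist_prod_def sqrt_sum_squares_le_sum)
      ultimately show "dist v w < \<delta>"
        by linarith
    qed auto
    show "\<exists>e>0. \<forall>c' d'. c' \<le> x \<and> x \<le> d' \<and> d' - c' < e \<longrightarrow> P (?R a b c' d')"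
      using \<delta>(1) by (intro exI[of _ "\<delta> / 2"] conjI allI impI loc) linarith+
  qed
  obtain a where a: "K \<subseteq> cbox (- a) a"
    by (rule bounded_subset_cbox_symmetric[OF compact_imp_bounded[OF K(1)]])
  define m where "m = \<bar>fst a\<bar> + \<bar>snd a\<bar>"
  have "K \<subseteq> {- m..m} \<times> {- m..m}"
  proof -
    obtain x y where xy: "a = (x, y)"
      by (cases a)
    have "cbox (- a) a \<subseteq> {- m..m} \<times> {- m..m}"
      by (auto simp: xy m_def cbox_Pair_eq)
    with a show ?thesis
      by (rule subset_trans)
  qed
  then have "?R (- m) m (- m) m = K"
    by auto
  \<comment> \<open>Bisection of the first coordinate; the small pieces are now entire strips,
    covered by \<open>tall\<close>.\<close>
  moreover have "P (?R (- m) m (- m) m)"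
  proof (rule Bolzano[where P = "\<lambda>x y. P (?R x y (- m) m)"])
    show "- m \<le> m"
      by (simp add: m_def)
  next
    fix x y z
    assume "P (?R x y (- m) m)" "P (?R y z (- m) m)" "x \<le> y" "y \<le> z"
    moreover from this have "?R x z (- m) m = ?R x y (- m) m \<union> ?R y z (- m) m"
      by auto
    ultimately show "P (?R x z (- m) m)"
      using glue[of "?R x y (- m) m" "?R y z (- m) m"] rect by simp
  next
    fix x
    have "- m \<le> m"
      by (simp add: m_def)
    then show "\<exists>d>0. \<forall>a b. a \<le> x \<and> x \<le> b \<and> b - a < d \<longrightarrow> P (?R a b (- m) m)"
      using \<delta>(1) by (intro exI[of _ "\<delta> / 2"] conjI allI impI tall) linarith+
  qed
  ultimately have "P K"
    by simp
  then show thesis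
    using that unfolding P_def by blast
qed

text \<open>The fundamental theorem of calculus for \<open>g \<circ> \<gamma>\<close>.
  Differentiability is borrowed from the ambient primitive that agrees with \<open>g\<close> along
  the curve near the given parameter, and continuity of \<open>g\<close> bridges the exceptional
  parameters in \<open>F\<close>.\<close>

lemma local_primitive_on_line_integral:
  assumes g: "local_primitive_on \<psi> A g" and \<gamma>A: "\<gamma> ` {u..v} \<subseteq> A" and "u \<le> v"
    and cont: "continuous_on {u..v} \<gamma>" and "finite F"
    and \<gamma>': "\<And>t. t \<in> {u<..<v} - F \<Longrightarrow> (\<gamma> has_vector_derivative \<gamma>' t) (at t)"
  shows "((\<lambda>t. \<psi> (\<gamma> t) \<odot> \<gamma>' t) has_integral g (\<gamma> v) - g (\<gamma> u)) {u..v}"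
proof -
  have "continuous_on A g"
    unfolding continuous_on_eq_continuous_within
  proof
    fix p
    assume p: "p \<in> A"
    obtain e \<Psi> where e: "e > 0" "bc_primitive_on \<psi> (ball p e) \<Psi>"
      "\<And>q. q \<in> A \<Longrightarrow> q \<in> ball p e \<Longrightarrow> g q = \<Psi> q"
      using local_primitive_onE[OF g p] by metis
    have "continuous (at p within A) \<Psi>"
      using e(1,2) unfolding bc_primitive_on_def
      by (meson centre_in_ball has_derivative_at_withinI has_derivative_continuous)
    then show "continuous (at p within A) g"
      by (rule continuous_transform_within[OF _ e(1) p]) (use e(3) in \<open>simp add: dist_commute\<close>)
  qed
  then have "continuous_on {u..v} (g \<circ> \<gamma>)"
    using cont \<gamma>A by (metis continuous_on_compose continuous_on_subset)
  moreover have "(g \<circ> \<gamma> has_vector_derivative \<psi> (\<gamma> t) \<odot> \<gamma>' t) (at t)" if t: "t \<in> {u<..<v} - F" for t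
  proof -
    have "\<gamma> t \<in> A"
      using t \<gamma>A by auto
    then obtain e \<Psi> where e: "e > 0" "bc_primitive_on \<psi> (ball (\<gamma> t) e) \<Psi>"
      "\<And>q. q \<in> A \<Longrightarrow> q \<in> ball (\<gamma> t) e \<Longrightarrow> g q = \<Psi> q"
      using local_primitive_onE[OF g] by metis
    have "(\<Psi> has_derivative (\<lambda>h. \<psi> (\<gamma> t) \<odot> h)) (at (\<gamma> t))"
      using e by (simp add: bc_primitive_on_def)
    from has_derivative_compose[OF \<gamma>'[OF t, unfolded has_vector_derivative_def] this]
    have "(\<Psi> \<circ> \<gamma> has_vector_derivative \<psi> (\<gamma> t) \<odot> \<gamma>' t) (at t)"
      by (simp add: has_vector_derivative_def o_def bc_mult_def scaleR_diff_right scaleR_add_right)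
    moreover have "open ({u<..<v} \<inter> \<gamma> -` ball (\<gamma> t) e)"
      by (intro continuous_open_preimage continuous_on_subset[OF cont]) auto
    moreover have "t \<in> {u<..<v} \<inter> \<gamma> -` ball (\<gamma> t) e"
      using t e by auto
    moreover have "(\<Psi> \<circ> \<gamma>) x = (g \<circ> \<gamma>) x" if "x \<in> {u<..<v} \<inter> \<gamma> -` ball (\<gamma> t) e" for x
    proof -
      have "\<gamma> x \<in> A" "\<gamma> x \<in> ball (\<gamma> t) e"
        using that \<gamma>A by auto
      then show ?thesis
        using e(3) by simp
    qed
    ultimately show ?thesis
      by (rule has_vector_derivative_transform_within_open)
  qed
  ultimately show ?thesis
    using fundamental_theorem_of_calculus_interior_strong[OF \<open>finite F\<close> \<open>u \<le> v\<close>, of "g \<circ> \<gamma>"] by auto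
qed

subsection \<open>Edges of a triangulated surface\<close>

definition edge_seg :: "nat \<Rightarrow> (real \<times> real) set"
  where "edge_seg k = closed_segment (tri_vertex k) (tri_vertex ((k + 1) mod 3))"

lemma less_3_cases: "k < 3 \<Longrightarrow> k = 0 \<or> k = 1 \<or> k = (2::nat)"
  by linarith

lemma compact_std_triangle: "compact std_triangle"
  and convex_std_triangle: "convex std_triangle"
  unfolding std_triangle_def
  by (simp_all add: finite_imp_compact_convex_hull)

lemma tri_vertex_in_std_triangle: "k < 3 \<Longrightarrow> tri_vertex k \<in> std_triangle"
  unfolding std_triangle_def by (rule hull_inc) (auto dest: less_3_cases)

lemma edge_seg_subset_std_triangle: "k < 3 \<Longrightarrow> edge_seg k \<subseteq> std_triangle"
  unfolding edge_seg_def
  by (intro closed_segment_subset convex_std_triangle tri_vertex_in_std_triangle) auto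

lemma tri_vertex_next_neq: "k < 3 \<Longrightarrow> tri_vertex k \<noteq> tri_vertex ((k + 1) mod 3)"
  by (auto dest!: less_3_cases simp: tri_vertex_def)

text \<open>Placing each side on its line is enough to see that two different sides meet at most in
  a vertex.\<close>

lemma edge_seg_coords:
  "edge_seg 0 \<subseteq> {x. snd x = 0}"
  "edge_seg 1 \<subseteq> {x. fst x + snd x = 1}"
  "edge_seg 2 \<subseteq> {x. fst x = 0}"
  by (auto simp: edge_seg_def tri_vertex_def closed_segment_def algebra_simps)

lemma edge_seg_Int:
  assumes "k < 3" "l < 3" "k \<noteq> l"
  obtains x where "edge_seg k \<inter> edge_seg l \<subseteq> {x}"
proof -
  have "edge_seg 0 \<inter> edge_seg 1 \<subseteq> {(1, 0)}" "edge_seg 1 \<inter> edge_seg 2 \<subseteq> {(0, 1)}"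
    "edge_seg 0 \<inter> edge_seg 2 \<subseteq> {(0, 0)}"
    using edge_seg_coords by (fastforce simp: prod_eq_iff)+
  then have "\<exists>x. edge_seg k \<inter> edge_seg l \<subseteq> {x}"
    using assms(3) less_3_cases[OF assms(1)] less_3_cases[OF assms(2)] by (metis Int_commute)
  then show thesis
    using that by blast
qed

lemma edge_seg_eq_iff:
  assumes "k < 3" "l < 3"
  shows "edge_seg k = edge_seg l \<longleftrightarrow> k = l"
proof
  assume eq: "edge_seg k = edge_seg l"
  show "k = l"
  proof (rule ccontr)
    assume "k \<noteq> l"
    then obtain x where "edge_seg k \<subseteq> {x}"
      using edge_seg_Int[OF assms] eq by (metis Int_absorb)
    moreover have "tri_vertex k \<in> edge_seg k" "tri_vertex ((k + 1) mod 3) \<in> edge_seg k"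
      by (simp_all add: edge_seg_def)
    ultimately show False
      using tri_vertex_next_neq[OF assms(1)] by (metis singletonD subsetD)
  qed
qed simp

lemma path_image_tri_edge: "path_image (tri_edge \<sigma> k) = \<sigma> ` edge_seg k"
  by (simp add: tri_edge_def edge_seg_def path_image_compose path_image_linepath del: linepath_image_01)

lemma pathstart_tri_edge: "pathstart (tri_edge \<sigma> k) = \<sigma> (tri_vertex k)"
  and pathfinish_tri_edge: "pathfinish (tri_edge \<sigma> k) = \<sigma> (tri_vertex ((k + 1) mod 3))"
  by (simp_all add: tri_edge_def pathstart_compose pathfinish_compose)

lemma smooth_triangle_continuous_on:
  assumes "smooth_triangle \<sigma>"
  shows "continuous_on std_triangle \<sigma>"
proof -
  obtain D :: "real \<times> real \<Rightarrow> (real \<times> real) \<Rightarrow>\<^sub>L bicomplex"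
    where "\<forall>x\<in>std_triangle. (\<sigma> has_derivative blinfun_apply (D x)) (at x within std_triangle)"
    using assms unfolding smooth_triangle_def by (elim conjE exE)
  then show ?thesis
    by (intro has_derivative_continuous_on[of _ _ "\<lambda>x. blinfun_apply (D x)"]) simp
qed

lemma smooth_triangle_inj_on: "smooth_triangle \<sigma> \<Longrightarrow> inj_on \<sigma> std_triangle"
  by (simp add: smooth_triangle_def)

lemma path_image_tri_edge_eq_iff:
  assumes "smooth_triangle \<sigma>" "k < 3" "l < 3"
  shows "path_image (tri_edge \<sigma> k) = path_image (tri_edge \<sigma> l) \<longleftrightarrow> k = l"
  using inj_on_image_eq_iff[OF smooth_triangle_inj_on] assms
  by (simp add: path_image_tri_edge edge_seg_subset_std_triangle edge_seg_eq_iff)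

lemma path_image_tri_edge_Int:
  assumes "smooth_triangle \<sigma>" "k < 3" "l < 3" "k \<noteq> l"
  obtains x where "path_image (tri_edge \<sigma> k) \<inter> path_image (tri_edge \<sigma> l) \<subseteq> {x}"
proof -
  obtain x where "edge_seg k \<inter> edge_seg l \<subseteq> {x}"
    using edge_seg_Int assms by metis
  then have "\<sigma> ` (edge_seg k \<inter> edge_seg l) \<subseteq> {\<sigma> x}"
    by blast
  then show thesis
    using that inj_on_image_Int[OF smooth_triangle_inj_on[OF assms(1)]] assms
    by (metis edge_seg_subset_std_triangle path_image_tri_edge)
qed

lemma path_image_tri_edge_subset: "k < 3 \<Longrightarrow> path_image (tri_edge \<sigma> k) \<subseteq> \<sigma> ` std_triangle"
  by (simp add: path_image_tri_edge edge_seg_subset_std_triangle image_mono)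

lemma pathstart_tri_edge_neq:
  assumes "smooth_triangle \<sigma>" "k < 3"
  shows "pathstart (tri_edge \<sigma> k) \<noteq> pathfinish (tri_edge \<sigma> k)"
  unfolding pathstart_tri_edge pathfinish_tri_edge
  using inj_onD[OF smooth_triangle_inj_on[OF assms(1)], of "tri_vertex k" "tri_vertex ((k + 1) mod 3)"]
    tri_vertex_next_neq[OF assms(2)] tri_vertex_in_std_triangle assms(2) by auto

section \<open>Free and shared edges, and cancellation of the shared ones\<close>

type_synonym marked_edge = "(real \<times> real \<Rightarrow> bicomplex) \<times> nat"

abbreviation edge_path :: "marked_edge \<Rightarrow> real \<Rightarrow> bicomplex"
  where "edge_path e \<equiv> tri_edge (fst e) (snd e)"

text \<open>An edge remembers its triangle, because the primitive evaluated at its endpoints belongs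
  to the triangle. A shared side thus occurs twice.\<close>

definition edges :: "(real \<times> real \<Rightarrow> bicomplex) set \<Rightarrow> marked_edge set"
  where "edges P = P \<times> {..<3}"

definition free_edges :: "(real \<times> real \<Rightarrow> bicomplex) set \<Rightarrow> marked_edge set"
  where "free_edges P = {e \<in> edges P. \<forall>e'\<in>edges P.
    path_image (edge_path e') = path_image (edge_path e) \<longrightarrow> fst e' = fst e}"

lemma boundary_edges_eq: "boundary_edges P = edge_path ` free_edges P"
proof -
  have "free_edges P = {(\<sigma>, k). \<sigma> \<in> P \<and> k < 3 \<and>
      (\<forall>\<tau>\<in>P. \<forall>l<3. path_image (tri_edge \<tau> l) = path_image (tri_edge \<sigma> k) \<longrightarrow> \<tau> = \<sigma>)}"
    unfolding free_edges_def edges_def by auto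
  then show ?thesis
    unfolding boundary_edges_def by (simp add: image_def) blast
qed

context
  fixes P :: "(real \<times> real \<Rightarrow> bicomplex) set" and S :: "bicomplex set"
  assumes triang: "oriented_triangulation P S"
begin

lemma finite_edges: "finite (edges P)"
  using triang by (simp add: oriented_triangulation_def edges_def)

lemma smooth_triangle: "e \<in> edges P \<Longrightarrow> smooth_triangle (fst e)"
  using triang by (auto simp: oriented_triangulation_def edges_def)

lemma edges_opposite:
  assumes "e \<in> edges P" "e' \<in> edges P" "fst e \<noteq> fst e'"
    and "path_image (edge_path e) = path_image (edge_path e')"
  shows "pathstart (edge_path e) = pathfinish (edge_path e')"
    and "pathfinish (edge_path e) = pathstart (edge_path e')"
  using triang assms unfolding oriented_triangulation_def edges_def mem_Times_iff lessThan_iff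
  by metis+

text \<open>If \<open>e1\<close> and \<open>e3\<close> came from different triangles, both would run
  opposite to \<open>e2\<close>, hence in the same direction, but also opposite to each other. The
  endpoints of \<open>e3\<close> would then coincide.\<close>

lemma edges_partner_unique:
  assumes e: "e1 \<in> edges P" "e2 \<in> edges P" "e3 \<in> edges P"
    and ne: "fst e1 \<noteq> fst e2" "fst e3 \<noteq> fst e2"
    and eq: "path_image (edge_path e1) = path_image (edge_path e2)"
      "path_image (edge_path e3) = path_image (edge_path e2)"
  shows "e1 = e3"
proof -
  have "fst e1 = fst e3"
  proof (rule ccontr)
    assume "fst e1 \<noteq> fst e3"
    then have "pathstart (edge_path e3) = pathfinish (edge_path e3)"
      using edges_opposite[OF e(1,2) ne(1) eq(1)] edges_opposite[OF e(3,2) ne(2) eq(2)]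
        edges_opposite[of e1 e3] e eq by metis
    moreover have "snd e3 < 3"
      using e by (auto simp: edges_def)
    ultimately show False
      using pathstart_tri_edge_neq smooth_triangle[OF e(3)] by metis
  qed
  moreover have "snd e1 = snd e3"
    using path_image_tri_edge_eq_iff[OF smooth_triangle[OF e(1)], of "snd e1" "snd e3"] e eq calculation
    by (auto simp: edges_def)
  ultimately show ?thesis
    by (simp add: prod_eq_iff)
qed

text \<open>This will keep the parameter intervals of distinct boundary edges from overlapping. If
  two triangles share a whole side, that side is not the free edge, so the free edge meets it, as
  another side of its own triangle, in at most one point.\<close>

lemma free_edges_Int:
  assumes e: "e \<in> free_edges P" "e' \<in> edges P" "e \<noteq> e'"
  obtains x where "path_image (edge_path e) \<inter> path_image (edge_path e') \<subseteq> {x}"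
proof (cases "fst e = fst e'")
  case True
  then have "snd e \<noteq> snd e'" "snd e < 3" "snd e' < 3"
    using e by (auto simp: prod_eq_iff free_edges_def edges_def)
  then show thesis
    using path_image_tri_edge_Int[OF smooth_triangle] that e True
    unfolding free_edges_def by (metis (no_types, lifting) mem_Collect_eq)
next
  case False
  let ?T = "fst e ` std_triangle" and ?T' = "fst e' ` std_triangle"
  have k: "fst e \<in> P" "fst e' \<in> P" "snd e < 3" "snd e' < 3"
    using e by (auto simp: free_edges_def edges_def)
  have sub: "path_image (edge_path e) \<inter> path_image (edge_path e') \<subseteq> ?T \<inter> ?T'"
    using path_image_tri_edge_subset k by (intro Int_mono) auto
  have "?T \<inter> ?T' = {} \<or> (\<exists>x. ?T \<inter> ?T' = {x}) \<or>
      (\<exists>k<3. \<exists>l<3. path_image (tri_edge (fst e) k) = path_image (tri_edge (fst e') l) \<and>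
         ?T \<inter> ?T' = path_image (tri_edge (fst e) k))"
    using triang k False unfolding oriented_triangulation_def by metis
  then consider x where "?T \<inter> ?T' \<subseteq> {x}"
    | l m where "l < 3" "m < 3" "path_image (tri_edge (fst e) l) = path_image (tri_edge (fst e') m)"
        "?T \<inter> ?T' = path_image (tri_edge (fst e) l)"
    by blast
  then show thesis
  proof cases
    case (1 x)
    with sub have "path_image (edge_path e) \<inter> path_image (edge_path e') \<subseteq> {x}"
      by (rule subset_trans)
    then show thesis
      by (rule that)
  next
    case (2 l m)
    have "(fst e', m) \<in> edges P"
      using 2 k by (simp add: edges_def)
    then have "snd e \<noteq> l"
      using e(1) 2 False by (force simp: free_edges_def)
    then obtain x where "path_image (edge_path e) \<inter> path_image (tri_edge (fst e) l) \<subseteq> {x}"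
      using path_image_tri_edge_Int[of "fst e" "snd e" l] 2 k e smooth_triangle
      unfolding free_edges_def by blast
    moreover have "path_image (edge_path e) \<inter> path_image (edge_path e')
        \<subseteq> path_image (edge_path e) \<inter> path_image (tri_edge (fst e) l)"
      using sub 2(4) by (metis Int_greatest Int_lower1)
    ultimately show thesis
      using that by (meson subset_trans)
  qed
qed

text \<open>The increments of \<open>g \<sigma>\<close> telescope around each triangle, so the sum
  over all marked edges is 0. The part over the edges that are not free is 0 as well, and the
  difference is the claim.\<close>

lemma sum_free_edges_eq_0:
  fixes g :: "(real \<times> real \<Rightarrow> bicomplex) \<Rightarrow> bicomplex \<Rightarrow> bicomplex"
  assumes g: "\<And>\<sigma>. \<sigma> \<in> P \<Longrightarrow> local_primitive_on \<psi> (\<sigma> ` std_triangle) (g \<sigma>)"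
  shows "(\<Sum>e\<in>free_edges P. g (fst e) (pathfinish (edge_path e)) - g (fst e) (pathstart (edge_path e))) = 0"
proof -
  define v where "v e = g (fst e) (pathfinish (edge_path e)) - g (fst e) (pathstart (edge_path e))" for e
  define N where "N = edges P - free_edges P"
  \<comment> \<open>The partner of a shared edge. It exists since the edge is not free, and its
    uniqueness makes \<open>\<pi>\<close> an involution of \<open>N\<close>.\<close>
  define \<pi> where "\<pi> e = (SOME e'. e' \<in> edges P \<and> fst e' \<noteq> fst e \<and>
      path_image (edge_path e') = path_image (edge_path e))" for e
  have \<pi>: "\<pi> e \<in> edges P" "fst (\<pi> e) \<noteq> fst e"
    "path_image (edge_path (\<pi> e)) = path_image (edge_path e)" if "e \<in> N" for e
  proof -
    have "\<exists>e'. e' \<in> edges P \<and> fst e' \<noteq> fst e \<and> path_image (edge_path e') = path_image (edge_path e)"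
      using that unfolding N_def free_edges_def by blast
    from someI_ex[OF this] show "\<pi> e \<in> edges P" "fst (\<pi> e) \<noteq> fst e"
      "path_image (edge_path (\<pi> e)) = path_image (edge_path e)"
      unfolding \<pi>_def by blast+
  qed
  have \<pi>_N: "\<pi> e \<in> N" if e: "e \<in> N" for e
  proof -
    have "e \<in> edges P"
      using e by (simp add: N_def)
    then show ?thesis
      using \<pi>[OF e] unfolding N_def free_edges_def by (metis (mono_tags, lifting) DiffI mem_Collect_eq)
  qed
  have \<pi>_\<pi>: "\<pi> (\<pi> e) = e" if e: "e \<in> N" for e
  proof (rule edges_partner_unique[OF \<pi>(1)[OF \<pi>_N[OF e]] \<pi>(1)[OF e]])
    show "e \<in> edges P"
      using e by (simp add: N_def)
  qed (use \<pi>[OF e] \<pi>[OF \<pi>_N[OF e]] in simp_all)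
  \<comment> \<open>On the common side the two primitives differ by a constant, which drops out of
    the increment; the reversed direction gives the sign.\<close>
  have v_\<pi>: "v (\<pi> e) = - v e" if e: "e \<in> N" for e
  proof -
    have E: "e \<in> edges P"
      using e by (simp add: N_def)
    let ?A = "path_image (edge_path e)"
    have sub: "?A \<subseteq> fst e ` std_triangle" "?A \<subseteq> fst (\<pi> e) ` std_triangle"
      using E \<pi>[OF e] path_image_tri_edge_subset[of "snd e" "fst e"]
        path_image_tri_edge_subset[of "snd (\<pi> e)" "fst (\<pi> e)"] by (auto simp: edges_def)
    have "connected ?A"
      unfolding path_image_tri_edge
      using E edge_seg_subset_std_triangle[of "snd e"]
      by (intro connected_continuous_image continuous_on_subset[OF smooth_triangle_continuous_on[OF smooth_triangle]])
        (auto simp: edges_def edge_seg_def)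
    moreover have "local_primitive_on \<psi> ?A (g (fst e))" "local_primitive_on \<psi> ?A (g (fst (\<pi> e)))"
      using E \<pi>[OF e] sub by (auto intro!: local_primitive_on_subset[OF g] simp: edges_def)
    ultimately obtain c where c: "\<And>p. p \<in> ?A \<Longrightarrow> g (fst e) p = g (fst (\<pi> e)) p + c"
      using local_primitive_on_unique by blast
    have "pathstart (edge_path (\<pi> e)) = pathfinish (edge_path e)"
      "pathfinish (edge_path (\<pi> e)) = pathstart (edge_path e)"
      using edges_opposite[OF \<pi>(1)[OF e] E \<pi>(2,3)[OF e]] by auto
    then show ?thesis
      using c[OF pathstart_in_path_image] c[OF pathfinish_in_path_image] by (simp add: v_def)
  qed
  \<comment> \<open>Reindexing by the involution makes the sum its own negative, with no need to
    choose an edge from each pair.\<close>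
  have "sum v N = (\<Sum>e\<in>N. v (\<pi> e))"
    by (rule sum.reindex_bij_witness[of _ \<pi> \<pi>]) (simp_all add: \<pi>_N \<pi>_\<pi>)
  then have "sum v N = - sum v N"
    by (simp add: v_\<pi> sum_negf)
  then have N0: "sum v N = 0"
    by (simp add: prod_eq_iff)
  have "{..<3} = {0, 1, 2 :: nat}"
    by auto
  then have "(\<Sum>k<3. v (\<sigma>, k)) = 0" for \<sigma>
    by (simp add: v_def pathstart_tri_edge pathfinish_tri_edge numeral_2_eq_2)
  then have "sum v (edges P) = 0"
    unfolding edges_def sum.cartesian_product' by simp
  moreover have "free_edges P \<subseteq> edges P"
    by (auto simp: free_edges_def)
  ultimately show ?thesis
    using N0 sum.subset_diff[of "free_edges P" "edges P" v] finite_edges by (simp add: N_def v_def)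
qed

end

section \<open>The boundary edges as a division of the parameter interval\<close>

theorem theorem5p5:
  fixes \<psi> :: "bicomplex \<Rightarrow> bicomplex" and G S :: "bicomplex set"
    and \<Gamma> :: "real \<Rightarrow> bicomplex" and r s :: real
  assumes "open G" and "connected G"
    and "bc_holomorphic_on \<psi> G"
    and "bc_curve \<Gamma> r s"
    and "bounds_orientable_surface \<Gamma> r s S"
    and "S \<subseteq> G"
  shows "has_bc_line_integral \<psi> 0 \<Gamma> r s"
proof -
  obtain P where P: "oriented_triangulation P S" and trav: "traverses_boundary \<Gamma> r s P"
    using assms(5) by (auto simp: bounds_orientable_surface_def)
  have "r \<le> s" and cont: "continuous_on {r..s} \<Gamma>"
    using assms(4) by (auto simp: bc_curve_def piecewise_C1_differentiable_on_def)
  obtain F where F: "finite F" "\<Gamma> C1_differentiable_on ({r..s} - F)"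
    using assms(4) by (auto simp: bc_curve_def piecewise_C1_differentiable_on_def)
  have closed: "\<Gamma> r = \<Gamma> s" and inj: "inj_on \<Gamma> {r..<s}"
    and image: "\<Gamma> ` {r..s} = (\<Union>e\<in>free_edges P. path_image (edge_path e))"
    using trav by (auto simp: traverses_boundary_def boundary_edges_eq)
  have "\<forall>e\<in>free_edges P. \<exists>u v. r \<le> u \<and> u < v \<and> v \<le> s \<and> \<Gamma> ` {u..v} = path_image (edge_path e) \<and>
      \<Gamma> u = pathstart (edge_path e) \<and> \<Gamma> v = pathfinish (edge_path e)"
    using trav by (simp add: traverses_boundary_def boundary_edges_eq)
  then obtain u v where uv: "\<And>e. e \<in> free_edges P \<Longrightarrow> r \<le> u e \<and> u e < v e \<and> v e \<le> s \<and>
      \<Gamma> ` {u e..v e} = path_image (edge_path e) \<and>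
      \<Gamma> (u e) = pathstart (edge_path e) \<and> \<Gamma> (v e) = pathfinish (edge_path e)"
    by metis
  have sub: "free_edges P \<subseteq> edges P"
    by (auto simp: free_edges_def)
  have fin: "finite (free_edges P)"
    using sub finite_edges[OF P] by (rule finite_subset)
  \<comment> \<open>The image of \<open>\<Gamma>\<close> is nonempty in any case, so some free edge
    exists, and it occupies an interval of positive length.\<close>
  have "r < s"
  proof -
    have "free_edges P \<noteq> {}"
      using image \<open>r \<le> s\<close> by auto
    then show ?thesis
      using uv by fastforce
  qed
  have "\<exists>g. local_primitive_on \<psi> (\<sigma> ` std_triangle) g" if "\<sigma> \<in> P" for \<sigma>
  proof -
    have "smooth_triangle \<sigma>" "\<sigma> ` std_triangle \<subseteq> G"
      using that P \<open>S \<subseteq> G\<close> by (auto simp: oriented_triangulation_def)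
    then show ?thesis
      using local_primitive_on_convex_image[OF assms(3,1) compact_std_triangle convex_std_triangle, of \<sigma>]
        smooth_triangle_continuous_on smooth_triangle_inj_on by metis
  qed
  then obtain g where g: "\<And>\<sigma>. \<sigma> \<in> P \<Longrightarrow> local_primitive_on \<psi> (\<sigma> ` std_triangle) (g \<sigma>)"
    by metis
  define f where "f t = \<psi> (\<Gamma> t) \<odot> vector_derivative \<Gamma> (at t within {r..s})" for t
  have f_edge: "(f has_integral g (fst e) (pathfinish (edge_path e)) - g (fst e) (pathstart (edge_path e)))
      {u e..v e}" if e: "e \<in> free_edges P" for e
  proof -
    have E: "fst e \<in> P" "snd e < 3"
      using e sub by (auto simp: edges_def)
    have "\<Gamma> ` {u e..v e} \<subseteq> fst e ` std_triangle"
      using uv[OF e] path_image_tri_edge_subset[OF E(2)] by simp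
    moreover have "continuous_on {u e..v e} \<Gamma>"
      using uv[OF e] by (intro continuous_on_subset[OF cont]) auto
    moreover have "(\<Gamma> has_vector_derivative vector_derivative \<Gamma> (at t within {r..s})) (at t)"
      if "t \<in> {u e<..<v e} - F" for t
    proof -
      have "t \<in> {r<..<s} - F"
        using that uv[OF e] by auto
      then have "\<Gamma> differentiable (at t)" "at t within {r..s} = at t"
        using F(2) by (auto simp: C1_differentiable_on_eq at_within_Icc_at)
      then show ?thesis
        by (simp add: vector_derivative_works)
    qed
    ultimately show ?thesis
      using local_primitive_on_line_integral[OF g[OF E(1)] _ _ _ F(1), of \<Gamma> "u e" "v e"] uv[OF e]
      unfolding f_def by simp
  qed
  \<comment> \<open>On an overlap \<open>\<Gamma>\<close> would take values in both edges, which
    share at most one point. It would be constant on an open interval, against injectivity.\<close>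
  have disj: "{u e<..<v e} \<inter> {u e'<..<v e'} = {}"
    if e: "e \<in> free_edges P" "e' \<in> free_edges P" "e \<noteq> e'" for e e'
  proof (rule ccontr)
    assume "{u e<..<v e} \<inter> {u e'<..<v e'} \<noteq> {}"
    define a b where "a = max (u e) (u e')" and "b = min (v e) (v e')"
    have "a < b"
      using \<open>_ \<noteq> {}\<close> by (auto simp: a_def b_def)
    then obtain t where t: "a < t" "t < b"
      using dense by blast
    obtain t' where t': "t < t'" "t' < b"
      using dense t by blast
    have "e' \<in> edges P"
      using e sub by blast
    then obtain x where x: "path_image (edge_path e) \<inter> path_image (edge_path e') \<subseteq> {x}"
      using free_edges_Int[OF P e(1) _ e(3)] by blast
    have \<Gamma>x: "\<Gamma> y = x" if "a < y" "y < b" for y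
    proof -
      have "y \<in> {u e..v e}" "y \<in> {u e'..v e'}"
        using that by (auto simp: a_def b_def)
      then show ?thesis
        using uv[OF e(1)] uv[OF e(2)] x by blast
    qed
    have "\<Gamma> t = \<Gamma> t'"
      using \<Gamma>x[of t] \<Gamma>x[of t'] t t' by simp
    moreover have "t \<in> {r..<s}" "t' \<in> {r..<s}"
      using t t' uv[OF e(1)] by (auto simp: a_def b_def)
    ultimately show False
      using inj t'(1) by (auto dest: inj_onD)
  qed
  let ?I = "\<lambda>e. {u e..v e}"
  \<comment> \<open>A division is a set of intervals; injectivity lets the sum over it be rewritten
    as a sum over edges.\<close>
  have I_inj: "inj_on ?I (free_edges P)"
  proof (rule inj_onI, rule ccontr)
    fix e e'
    assume e: "e \<in> free_edges P" "e' \<in> free_edges P" "?I e = ?I e'" "e \<noteq> e'"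
    then have "u e = u e'" "v e = v e'"
      using uv[OF e(1)] uv[OF e(2)] by (auto simp: Icc_eq_Icc)
    then have "{u e<..<v e} = {}"
      using disj[OF e(1,2,4)] by simp
    then show False
      using uv[OF e(1)] by simp
  qed
  have "?I ` free_edges P division_of {r..s}"
    unfolding division_of_def
  proof (intro conjI ballI impI)
    show "finite (?I ` free_edges P)"
      using fin by simp
  next
    fix K
    assume "K \<in> ?I ` free_edges P"
    then obtain e where e: "e \<in> free_edges P" "K = ?I e"
      by blast
    show "K \<subseteq> {r..s}" "K \<noteq> {}"
      using uv[OF e(1)] e by auto
    show "\<exists>a b. K = cbox a b"
      using e by (metis cbox_interval)
  next
    fix K K'
    assume "K \<in> ?I ` free_edges P" "K' \<in> ?I ` free_edges P" "K \<noteq> K'"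
    then obtain e e' where "K = ?I e" "K' = ?I e'" "e \<in> free_edges P" "e' \<in> free_edges P" "e \<noteq> e'"
      by blast
    then show "interior K \<inter> interior K' = {}"
      using disj by (simp add: interior_atLeastAtMost_real)
  next
    \<comment> \<open>Injectivity identifies parameters only away from the common point
      \<open>\<Gamma> r = \<Gamma> s\<close>. The two endpoints are recovered afterwards, since a
      finite union of closed intervals is closed.\<close>
    have "{r<..<s} \<subseteq> (\<Union>e\<in>free_edges P. ?I e)"
    proof
      fix t
      assume t: "t \<in> {r<..<s}"
      then have "\<Gamma> t \<in> \<Gamma> ` {r..s}"
        by auto
      then obtain e where e: "e \<in> free_edges P" "\<Gamma> t \<in> path_image (edge_path e)"
        unfolding image by blast
      then obtain t' where t': "t' \<in> ?I e" "\<Gamma> t' = \<Gamma> t"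
        using uv[OF e(1)] by (metis imageE)
      have "t' \<noteq> s"
      proof
        assume "t' = s"
        then have "\<Gamma> r = \<Gamma> t"
          using t' closed by simp
        then show False
          using inj_onD[OF inj, of r t] t by auto
      qed
      then have "t' = t"
        using inj_onD[OF inj t'(2)] t t'(1) uv[OF e(1)] by auto
      then show "t \<in> (\<Union>e\<in>free_edges P. ?I e)"
        using e t' by blast
    qed
    moreover have "closed (\<Union>e\<in>free_edges P. ?I e)"
      using fin by auto
    ultimately have "closure {r<..<s} \<subseteq> (\<Union>e\<in>free_edges P. ?I e)"
      by (rule closure_minimal)
    then show "\<Union> (?I ` free_edges P) = {r..s}"
      using \<open>r < s\<close> uv by (fastforce simp: closure_greaterThanLessThan)
  qed
  then have "(f has_integral (\<Sum>K\<in>?I ` free_edges P. integral K f)) {r..s}"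
    by (rule has_integral_combine_division) (use f_edge in \<open>auto intro: integrable_integral\<close>)
  also have "(\<Sum>K\<in>?I ` free_edges P. integral K f) = (\<Sum>e\<in>free_edges P. integral (?I e) f)"
    by (simp add: sum.reindex[OF I_inj])
  also have "\<dots> = (\<Sum>e\<in>free_edges P. g (fst e) (pathfinish (edge_path e)) -
      g (fst e) (pathstart (edge_path e)))"
    by (intro sum.cong refl integral_unique f_edge)
  also have "\<dots> = 0"
    by (rule sum_free_edges_eq_0[OF P g])
  finally show ?thesis
    by (simp add: has_bc_line_integral_def f_def[abs_def])
qed

end
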